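(* Let $K$ be an oriented virtual knot diagram such that every real crossing $c$ of $K$ has $\mathrm{Ind}(c)=0$. Then $F_K(t,s)=0$. In particular, $F_K(t,s)=0$ for every classical knot diagram $K$ (a diagram with no virtual crossings).
   Context: The Gauss diagram $G(K)$ of an oriented virtual knot diagram $K$ is built as follows. Take a counterclockwise-oriented circle. For each real crossing, join its two preimages by a chord directed from over- to undercrossing, labeled with the writhe $w(c)=\pm1$. Put $w(K)=\sum_c w(c)$. Let $d$ be a chord intersecting a chord $c$ (endpoints interleave). We say $d$ crosses $c$ from left to right if, viewing $c$ along its direction, the tail of $d$ lies on the left and its head on the right; right to left is the opposite. Let $r_1,\dots,r_n$ be the chords crossing $c$ from left to right and $l_1,\dots,l_m$ those crossing from right to left. Then $\mathrm{Ind}(c)=\sum_i w(r_i)-\sum_j w(l_j)$. Put $N=|\mathrm{Ind}(c)|$ and let $\phi$ be reduction mod $N$ into $\{0,\dots,N-1\}$ if $N\ge1$, and the identity if $N=0$. Define $$g_c(s)=\sum_i w(r_i)s^{\phi(\mathrm{Ind}(r_i))}-\sum_j w(l_j)s^{\phi(-\mathrm{Ind}(l_j))}.$$ Call Laurent polynomials $p,q$ equivalent if $p(1)=q(1)$ and $p\equiv q\pmod{s^{|p(1)|}-1}$. Write $t^{[p]}$ for the corresponding basis element of the free abelian group on equivalence classes. Then $$F_K(t,s)=\sum_c w(c)\,t^{[g_c(s)]}-w(K)\,t^{[0]},$$ summing over all real crossings. *)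

theory Defs
  imports "HOL-Computational_Algebra.Formal_Laurent_Series"
begin

text \<open>Endpoints are points of the circle,
encoded as natural numbers; the counterclockwise orientation of the circle is the cyclic
order of nat (increasing, wrapping around). Each chord c is directed from its tail
(overcrossing preimage) to its head (undercrossing preimage) and carries a writhe w c.\<close>

definition gauss_diagram :: "'c set \<Rightarrow> ('c \<Rightarrow> nat) \<Rightarrow> ('c \<Rightarrow> nat) \<Rightarrow> ('c \<Rightarrow> int) \<Rightarrow> bool" where
  "gauss_diagram C tail head w \<longleftrightarrow> finite C
     \<and> (\<forall>c\<in>C. tail c \<noteq> head c)
     \<and> (\<forall>c\<in>C. \<forall>d\<in>C. c \<noteq> d \<longrightarrow> {tail c, head c} \<inter> {tail d, head d} = {})
     \<and> (\<forall>c\<in>C. w c = 1 \<or> w c = -1)"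

definition ccw_arc :: "nat \<Rightarrow> nat \<Rightarrow> nat \<Rightarrow> bool" where
  "ccw_arc a b x \<longleftrightarrow> (if a < b then a < x \<and> x < b else a < x \<or> x < b)"

text \<open>Viewing c along its direction (counterclockwise circle), the right side of c is the
counterclockwise arc from tail c to head c, the left side the arc from head c to tail c.
d crosses c from left to right: tail of d on the left, head of d on the right.\<close>
definition crosses_lr :: "('c \<Rightarrow> nat) \<Rightarrow> ('c \<Rightarrow> nat) \<Rightarrow> 'c \<Rightarrow> 'c \<Rightarrow> bool" where
  "crosses_lr tail head d c \<longleftrightarrow> ccw_arc (head c) (tail c) (tail d) \<and> ccw_arc (tail c) (head c) (head d)"

definition crosses_rl :: "('c \<Rightarrow> nat) \<Rightarrow> ('c \<Rightarrow> nat) \<Rightarrow> 'c \<Rightarrow> 'c \<Rightarrow> bool" where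
  "crosses_rl tail head d c \<longleftrightarrow> ccw_arc (tail c) (head c) (tail d) \<and> ccw_arc (head c) (tail c) (head d)"

definition chord_index :: "'c set \<Rightarrow> ('c \<Rightarrow> nat) \<Rightarrow> ('c \<Rightarrow> nat) \<Rightarrow> ('c \<Rightarrow> int) \<Rightarrow> 'c \<Rightarrow> int" where
  "chord_index C tail head w c =
     (\<Sum>r\<in>{r\<in>C. crosses_lr tail head r c}. w r) - (\<Sum>l\<in>{l\<in>C. crosses_rl tail head l c}. w l)"

definition writhe :: "'c set \<Rightarrow> ('c \<Rightarrow> int) \<Rightarrow> int" where
  "writhe C w = (\<Sum>c\<in>C. w c)"

text \<open>Laurent polynomials over int: formal Laurent series with finitely many nonzero
coefficients; the variable s is fls_X, s^k is fls_X_intpow k.\<close>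

definition is_laurent_poly :: "int fls \<Rightarrow> bool" where
  "is_laurent_poly p \<longleftrightarrow> finite {n. fls_nth p n \<noteq> 0}"

definition lp_eval1 :: "int fls \<Rightarrow> int" where
  "lp_eval1 p = (\<Sum>n\<in>{n. fls_nth p n \<noteq> 0}. fls_nth p n)"

definition lp_cong :: "int fls \<Rightarrow> int fls \<Rightarrow> int fls \<Rightarrow> bool" where
  "lp_cong p q m \<longleftrightarrow> (\<exists>h. is_laurent_poly h \<and> p - q = m * h)"

definition lp_equiv :: "int fls \<Rightarrow> int fls \<Rightarrow> bool" where
  "lp_equiv p q \<longleftrightarrow> lp_eval1 p = lp_eval1 q
      \<and> lp_cong p q (fls_X ^ nat \<bar>lp_eval1 p\<bar> - 1)"

definition lp_class :: "int fls \<Rightarrow> int fls set" where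
  "lp_class p = {q. is_laurent_poly q \<and> lp_equiv p q}"

definition phi_red :: "int \<Rightarrow> int \<Rightarrow> int" where
  "phi_red N k = (if N \<ge> 1 then k mod N else k)"

definition g_poly :: "'c set \<Rightarrow> ('c \<Rightarrow> nat) \<Rightarrow> ('c \<Rightarrow> nat) \<Rightarrow> ('c \<Rightarrow> int) \<Rightarrow> 'c \<Rightarrow> int fls" where
  "g_poly C tail head w c =
     (let N = \<bar>chord_index C tail head w c\<bar> in
       (\<Sum>r\<in>{r\<in>C. crosses_lr tail head r c}.
           of_int (w r) * fls_X_intpow (phi_red N (chord_index C tail head w r)))
     - (\<Sum>l\<in>{l\<in>C. crosses_rl tail head l c}.
           of_int (w l) * fls_X_intpow (phi_red N (- chord_index C tail head w l))))"

text \<open>F_K as an element of the free abelian group on equivalence classes, represented by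
its coefficient function: the coefficient of t^[Q] for each class Q.\<close>
definition F_inv :: "'c set \<Rightarrow> ('c \<Rightarrow> nat) \<Rightarrow> ('c \<Rightarrow> nat) \<Rightarrow> ('c \<Rightarrow> int) \<Rightarrow> int fls set \<Rightarrow> int" where
  "F_inv C tail head w Q =
     (\<Sum>c\<in>{c\<in>C. lp_class (g_poly C tail head w c) = Q}. w c)
     - (if Q = lp_class 0 then writhe C w else 0)"

end

theory Submission
  imports Defs
begin

text \<open>When all indices vanish, every monomial of g_c is s^0, so g_c collapses to the
integer Ind(c) = 0. Hence every chord contributes w(c) t^[0], and the total w(K) t^[0]
is cancelled by the correction term.\<close>

lemma phi_red_zero [simp]: "phi_red N 0 = 0"
  by (simp add: phi_red_def)

lemma g_poly_eq_chord_index: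
  assumes "\<forall>d\<in>C. chord_index C tail head w d = 0"
  shows "g_poly C tail head w c = of_int (chord_index C tail head w c)"
  using assms by (simp add: g_poly_def chord_index_def of_int_sum)

lemma F_inv_eq_zero_if_g_poly_trivial:
  assumes "\<forall>c\<in>C. lp_class (g_poly C tail head w c) = lp_class 0"
  shows "F_inv C tail head w = (\<lambda>Q. 0)"
proof
  fix Q
  have "{c\<in>C. lp_class (g_poly C tail head w c) = Q} = (if Q = lp_class 0 then C else {})"
    using assms by auto
  then show "F_inv C tail head w Q = 0"
    by (simp add: F_inv_def writhe_def)
qed

theorem proposition5p1:
  fixes C :: "'c set" and tail head :: "'c \<Rightarrow> nat" and w :: "'c \<Rightarrow> int"
  assumes "gauss_diagram C tail head w"
    and "\<forall>c\<in>C. chord_index C tail head w c = 0"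
  shows "F_inv C tail head w = (\<lambda>Q. 0)"
proof (rule F_inv_eq_zero_if_g_poly_trivial, intro ballI)
  fix c
  assume "c \<in> C"
  then have "g_poly C tail head w c = 0"
    using assms(2) g_poly_eq_chord_index[OF assms(2)] by simp
  then show "lp_class (g_poly C tail head w c) = lp_class 0"
    by simp
qed

end
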